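(* Let $T$ be a compact domain, let $V\subseteq C(T)$ be a finite-dimensional linear space with basis $v_1,\ldots,v_n$, and let $H=\{h_1,\ldots,h_N\}\subseteq T$ be a finite set. If best discrete Chebyshev approximation of data $f_H\in\mathbb{R}^N$ on $H$ by functions from $V$ is written as a Linear Optimization problem, one gets an $H$-set for $V$ for free, as a subset of the extremal points with associated signs, provided that calculations are exact and a solution of the dual problem is provided as well.
   Context: $C(T)$ is the space of continuous real-valued functions on $T$. Definition ($H$-set). An $H$-set for $V\subseteq C(T)$ consists of a subset $H_0\subseteq T$ and a sign function $\sigma:H_0\to\{-1,+1\}$ such that there is no $v\in V$ that makes all values $v(h)\sigma(h)$, $h\in H_0$, negative. Linear Optimization problem. Let $B$ be the $N\times n$ matrix with entry $v_i(h_k)$ in row $k$ and column $i$, let $\mathbf{1}\in\mathbb{R}^N$ be the all-ones vector, and read vector inequalities componentwise. Best discrete Chebyshev approximation of $f_H$ on $H$ is written as: minimize $\eta$ over $(x,\eta)\in\mathbb{R}^n\times\mathbb{R}$ subject to $-Bx-\eta\mathbf{1}\le -f_H$ and $Bx-\eta\mathbf{1}\le f_H$. The dual problem is: maximize $f_H^Tw$ over $w\in\mathbb{R}^N$ subject to $B^Tw=0$ and $\|w\|_1=1$ (implemented by splitting $w=w^+-w^-$ into positive and negative parts). Extremal points and signs. If $(x^*,\eta^* )$ is an optimal solution of the minimization problem, so that $\eta^*=\|f_H-Bx^*\|_\infty$ (maximum norm on $\mathbb{R}^N$), the extremal points are the $h_k\in H$ with $|(f_H-Bx^* )_k|=\eta^*$,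 and the associated signs are the signs $\operatorname{sgn}\big((f_H-Bx^* )_k\big)$ of the error there. "For free" means that the $H$-set comes along with the solutions of the Linear Optimization problem and its dual.
   Formalization: If the data are matched exactly on H (optimal η = 0), the errors vanish and have no sign ±1; agreement with the error's sign is therefore claimed only where the error is nonzero. The H-set, with the signs of the dual solution, and its extremality are claimed in all cases. *)

theory Defs
  imports "HOL-Analysis.Analysis" "HOL-Library.Function_Algebras"
begin

text \<open>Real-valued functions form a real vector space under pointwise operations; the
  interpretation makes the library notions of span and linear independence available for them.\<close>

interpretation fun_space: vector_space "\<lambda>(c::real) (f::'a \<Rightarrow> real) t. c * f t"
  by unfold_locales (auto simp: fun_eq_iff algebra_simps)

text \<open>A function on \<open>T\<close> is represented by its extension by \<open>0\<close> to the whole type, so that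
  equality, linear operations and linear independence are those of functions on \<open>T\<close>.\<close>

definition C_space :: "'a::topological_space set \<Rightarrow> ('a \<Rightarrow> real) set" where
  "C_space T = {f. continuous_on T f \<and> (\<forall>t. t \<notin> T \<longrightarrow> f t = 0)}"

definition is_H_set :: "'a set \<Rightarrow> ('a \<Rightarrow> real) set \<Rightarrow> 'a set \<Rightarrow> ('a \<Rightarrow> real) \<Rightarrow> bool" where
  "is_H_set T V H0 \<sigma> \<longleftrightarrow>
     H0 \<subseteq> T \<and> \<sigma> ` H0 \<subseteq> {-1, 1} \<and> \<not> (\<exists>v\<in>V. \<forall>t\<in>H0. v t * \<sigma> t < 0)"

definition sample_matrix :: "('n \<Rightarrow> 'a \<Rightarrow> real) \<Rightarrow> ('m \<Rightarrow> 'a) \<Rightarrow> real^'n^'m" where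
  "sample_matrix v h = (\<chi> k i. v i (h k))"

text \<open>The order on vectors is componentwise, and \<open>vec 1\<close> is the all-ones vector.\<close>

definition primal_feasible :: "real^'n^'m \<Rightarrow> real^'m \<Rightarrow> (real^'n) \<times> real \<Rightarrow> bool" where
  "primal_feasible B f = (\<lambda>(x, \<eta>).
     - (B *v x) - \<eta> *\<^sub>R vec 1 \<le> - f \<and> B *v x - \<eta> *\<^sub>R vec 1 \<le> f)"

definition primal_optimal :: "real^'n^'m \<Rightarrow> real^'m \<Rightarrow> (real^'n) \<times> real \<Rightarrow> bool" where
  "primal_optimal B f = is_arg_min snd (primal_feasible B f)"

definition dual_feasible :: "real^'n^'m \<Rightarrow> real^'m \<Rightarrow> bool" where
  "dual_feasible B w \<longleftrightarrow> transpose B *v w = 0 \<and> (\<Sum>k\<in>UNIV. \<bar>w $ k\<bar>) = 1"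

definition dual_optimal :: "real^'n^'m \<Rightarrow> real^'m \<Rightarrow> real^'m \<Rightarrow> bool" where
  "dual_optimal B f = is_arg_max (\<lambda>w. f \<bullet> w) (dual_feasible B)"

definition extremal_points ::
    "real^'n^'m \<Rightarrow> real^'m \<Rightarrow> ('m \<Rightarrow> 'a) \<Rightarrow> (real^'n) \<times> real \<Rightarrow> 'a set" where
  "extremal_points B f h = (\<lambda>(x, \<eta>). h ` {k. \<bar>(f - B *v x) $ k\<bar> = \<eta>})"

text \<open>The candidate \<open>H\<close>-set that is read off from a dual solution \<open>w\<close>: its support, with the
  signs of its entries. The index belonging to a point is \<open>inv h\<close>, as \<open>h\<close> is injective.\<close>

definition dual_support :: "('m \<Rightarrow> 'a) \<Rightarrow> real^'m \<Rightarrow> 'a set" where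
  "dual_support h w = h ` {k. w $ k \<noteq> 0}"

definition dual_sign :: "('m \<Rightarrow> 'a) \<Rightarrow> real^'m \<Rightarrow> 'a \<Rightarrow> real" where
  "dual_sign h w t = sgn (w $ inv h t)"

end

theory Submission
  imports Defs
begin

text \<open>Dual feasibility of \<open>w\<close> says that the functional \<open>g \<mapsto> \<Sum>\<^sub>k w\<^sub>k g(h\<^sub>k)\<close> annihilates \<open>V\<close>,
  so no \<open>g \<in> V\<close> can have sign opposite to \<open>w\<close> on the whole support. For the position of the
  support, let \<open>r = f - Bx\<close>. Then \<open>f \<bullet> w = r \<bullet> w \<le> \<eta> \<parallel>w\<parallel>\<^sub>1 = \<eta>\<close> for every dual feasible \<open>w\<close>, and
  equality forces \<open>w\<^sub>k r\<^sub>k = \<eta> \<bar>w\<^sub>k\<bar>\<close> for all \<open>k\<close>. If \<open>\<eta> = 0\<close> this is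
  trivial, as \<open>r = 0\<close>. If \<open>\<eta> > 0\<close>, equality is attained: otherwise a hyperplane separates \<open>0\<close> from
  the image under \<open>B\<^sup>T\<close> of the compact convex set of all \<open>w\<close> with \<open>\<parallel>w\<parallel>\<^sub>1 \<le> 1\<close> and \<open>r \<bullet> w = \<eta>\<close>, and
  its normal is a direction in which \<open>x\<close> can be improved.\<close>

section \<open>Descent directions for the discrete Chebyshev problem\<close>

lemma primal_feasible_iff:
  "primal_feasible B f (x, \<eta>) \<longleftrightarrow> (\<forall>k. \<bar>(f - B *v x) $ k\<bar> \<le> \<eta>)"
  unfolding primal_feasible_def
  by (auto simp: less_eq_vec_def abs_le_iff algebra_simps)

text \<open>Where \<open>\<bar>r\<bar> < \<eta>\<close>, continuity suffices. Where
  \<open>\<bar>r\<bar> = \<eta>\<close>, \<open>d\<close> has the sign of \<open>r\<close>, so the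
  step moves \<open>r\<close> towards 0, and it does not overshoot to the opposite bound while
  \<open>e * \<bar>d\<bar> < 2 * \<eta>\<close>.\<close>

lemma eventually_abs_diff_less:
  fixes r d \<eta> :: real
  assumes "\<bar>r\<bar> \<le> \<eta>" "0 < \<eta>" "\<bar>r\<bar> = \<eta> \<Longrightarrow> 0 < sgn r * d"
  shows "\<forall>\<^sub>F e in at_right 0. \<bar>r - e * d\<bar> < \<eta>"
proof (cases "\<bar>r\<bar> = \<eta>")
  case True
  have "((\<lambda>e. e * \<bar>d\<bar>) \<longlongrightarrow> 0 * \<bar>d\<bar>) (at_right 0)"
    by (intro tendsto_intros)
  then have "\<forall>\<^sub>F e in at_right 0. e * \<bar>d\<bar> < 2 * \<eta>"
    using \<open>0 < \<eta>\<close> by (intro order_tendstoD(2)) auto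
  then show ?thesis
    using eventually_at_right_less[of "0::real"]
  proof eventually_elim
    case (elim e)
    have "d \<noteq> 0"
      using assms(3)[OF True] by auto
    then have "0 < e * \<bar>d\<bar>"
      using elim by simp
    moreover have "\<bar>r - e * d\<bar> = \<bar>\<eta> - e * \<bar>d\<bar>\<bar>"
      using assms(3)[OF True] True by (auto simp: sgn_if abs_if split: if_splits)
    ultimately show ?case
      using elim by linarith
  qed
next
  case False
  have "((\<lambda>e. \<bar>r - e * d\<bar>) \<longlongrightarrow> \<bar>r - 0 * d\<bar>) (at_right 0)"
    by (intro tendsto_intros)
  then show ?thesis
    by (rule order_tendstoD(2)) (use assms False in simp)
qed

lemma primal_optimal_residual_le:
  assumes "primal_optimal B f (x, \<eta>)"
  shows "\<bar>(f - B *v x) $ k\<bar> \<le> \<eta>"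
  using assms unfolding primal_optimal_def is_arg_min_def primal_feasible_iff by blast

text \<open>There are finitely many indices, so one small step \<open>e\<close> along
  \<open>a\<close> brings all errors strictly below \<open>\<eta>\<close> at once; their maximum is
  then a better objective value.\<close>

lemma primal_optimal_no_descent:
  fixes B :: "real^'n^'m::finite"
  assumes opt: "primal_optimal B f (x, \<eta>)" and "0 < \<eta>"
  shows "\<not> (\<forall>k. \<bar>(f - B *v x) $ k\<bar> = \<eta> \<longrightarrow> 0 < sgn ((f - B *v x) $ k) * (B *v a) $ k)"
proof
  let ?r = "f - B *v x"
  assume desc: "\<forall>k. \<bar>?r $ k\<bar> = \<eta> \<longrightarrow> 0 < sgn (?r $ k) * (B *v a) $ k"
  have "\<forall>\<^sub>F e in at_right 0. \<forall>k\<in>UNIV. \<bar>?r $ k - e * (B *v a) $ k\<bar> < \<eta>"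
    using desc primal_optimal_residual_le[OF opt] \<open>0 < \<eta>\<close>
    by (intro eventually_ball_finite ballI eventually_abs_diff_less) auto
  then obtain e where e: "\<And>k. \<bar>?r $ k - e * (B *v a) $ k\<bar> < \<eta>"
    using eventually_happens'[OF trivial_limit_at_right_real] by fast
  let ?M = "Max (range (\<lambda>k. \<bar>?r $ k - e * (B *v a) $ k\<bar>))"
  have "primal_feasible B f (x + e *\<^sub>R a, ?M)"
    unfolding primal_feasible_iff
    by (auto intro!: Max_ge simp: matrix_vector_right_distrib matrix_vector_mult_scaleR diff_diff_eq)
  moreover have "?M < \<eta>"
    using e by (subst Max_less_iff) auto
  ultimately show False
    using opt unfolding primal_optimal_def is_arg_min_def by (metis snd_conv)
qed

section \<open>Duality by separation\<close>

lemma compact_l1_hyperplane: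
  fixes r :: "real^'m::finite"
  shows "compact {w. (\<Sum>k\<in>UNIV. \<bar>w $ k\<bar>) \<le> 1 \<and> r \<bullet> w = \<eta>}"
  unfolding compact_eq_bounded_closed
proof
  show "bounded {w. (\<Sum>k\<in>UNIV. \<bar>w $ k\<bar>) \<le> 1 \<and> r \<bullet> w = \<eta>}"
    by (rule boundedI[of _ 1]) (auto intro: order_trans[OF norm_le_l1_cart])
  show "closed {w. (\<Sum>k\<in>UNIV. \<bar>w $ k\<bar>) \<le> 1 \<and> r \<bullet> w = \<eta>}"
    by (intro closed_Collect_conj closed_Collect_le closed_Collect_eq continuous_intros)
qed

lemma convex_l1_hyperplane:
  fixes r :: "real^'m::finite"
  shows "convex {w. (\<Sum>k\<in>UNIV. \<bar>w $ k\<bar>) \<le> 1 \<and> r \<bullet> w = \<eta>}"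
proof (rule convexI, clarsimp, intro conjI)
  fix y z :: "real^'m" and u v :: real
  assume uv: "0 \<le> u" "0 \<le> v" "u + v = 1"
    and y: "(\<Sum>k\<in>UNIV. \<bar>y $ k\<bar>) \<le> 1" and z: "(\<Sum>k\<in>UNIV. \<bar>z $ k\<bar>) \<le> 1"
    and eq: "r \<bullet> z = r \<bullet> y"
  have "(\<Sum>k\<in>UNIV. \<bar>u * y $ k + v * z $ k\<bar>) \<le> (\<Sum>k\<in>UNIV. u * \<bar>y $ k\<bar> + v * \<bar>z $ k\<bar>)"
    using uv by (intro sum_mono order_trans[OF abs_triangle_ineq]) (simp add: abs_mult)
  also have "\<dots> = u * (\<Sum>k\<in>UNIV. \<bar>y $ k\<bar>) + v * (\<Sum>k\<in>UNIV. \<bar>z $ k\<bar>)"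
    by (simp add: sum.distrib sum_distrib_left)
  also have "\<dots> \<le> 1"
    using convex_bound_le[OF y z] uv by auto
  finally show "(\<Sum>k\<in>UNIV. \<bar>u * y $ k + v * z $ k\<bar>) \<le> 1" .
  show "r \<bullet> (u *\<^sub>R y + v *\<^sub>R z) = r \<bullet> y"
    using uv eq by (simp add: inner_add_right flip: distrib_right)
qed

lemma mult_le_mult_abs:
  fixes a b c :: real
  assumes "\<bar>a\<bar> \<le> c"
  shows "a * b \<le> c * \<bar>b\<bar>"
proof -
  have "a * b \<le> \<bar>a\<bar> * \<bar>b\<bar>"
    by (simp flip: abs_mult)
  also have "\<dots> \<le> c * \<bar>b\<bar>"
    using assms by (simp add: mult_right_mono)
  finally show ?thesis .
qed

lemma inner_le_l1:
  fixes r w :: "real^'m::finite"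
  assumes "\<And>k. \<bar>r $ k\<bar> \<le> \<eta>"
  shows "r \<bullet> w \<le> \<eta> * (\<Sum>k\<in>UNIV. \<bar>w $ k\<bar>)"
  unfolding inner_vec_def sum_distrib_left
  by (auto intro!: sum_mono mult_le_mult_abs assms)

lemma inner_transpose_matrix_vector:
  fixes B :: "real^'n::finite^'m::finite"
  shows "a \<bullet> (transpose B *v w) = (B *v a) \<bullet> w"
  by (simp add: inner_commute[of a] dot_lmul_matrix)
     (simp add: inner_commute)

text \<open>The two sides differ by \<open>(B *v x) \<bullet> w\<close>, which is
  \<open>x \<bullet> (transpose B *v w) = 0\<close>.\<close>

lemma dual_feasible_inner_residual:
  assumes "dual_feasible B w"
  shows "f \<bullet> w = (f - B *v x) \<bullet> w"
  using assms
  by (simp add: dual_feasible_def inner_diff_left flip: inner_transpose_matrix_vector)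

lemma ex_dual_feasible_attaining:
  fixes B :: "real^'n^'m::finite"
  assumes opt: "primal_optimal B f (x, \<eta>)" and "0 < \<eta>"
  shows "\<exists>w. dual_feasible B w \<and> f \<bullet> w = \<eta>"
proof -
  let ?r = "f - B *v x"
  let ?W = "{w. (\<Sum>k\<in>UNIV. \<bar>w $ k\<bar>) \<le> 1 \<and> ?r \<bullet> w = \<eta>}"
  let ?A = "\<lambda>w. transpose B *v w"
  have "0 \<in> ?A ` ?W"
  proof (rule ccontr)
    assume "0 \<notin> ?A ` ?W"
    moreover have "convex (?A ` ?W)"
      by (intro convex_linear_image convex_l1_hyperplane matrix_vector_mul_linear)
    moreover have "closed (?A ` ?W)"
      by (intro compact_imp_closed compact_continuous_image compact_l1_hyperplane
          linear_continuous_on matrix_vector_mul_bounded_linear)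
    ultimately obtain a b where "0 < b" and ab: "\<forall>y\<in>?A ` ?W. b < a \<bullet> y"
      using separating_hyperplane_closed_0[of "?A ` ?W"] by auto
    have "0 < sgn (?r $ k) * (B *v a) $ k" if k: "\<bar>?r $ k\<bar> = \<eta>" for k
    proof -
      \<comment> \<open>A signed unit vector at an extremal index lies in \<open>?W\<close>, and
        testing the hyperplane on it isolates component \<open>k\<close> of
        \<open>B *v a\<close>.\<close>
      let ?e = "axis k (sgn (?r $ k))"
      have "(\<Sum>j\<in>UNIV. \<bar>?e $ j\<bar>) = \<bar>sgn (?r $ k)\<bar>"
        by (subst sum.remove[of _ k]) (auto simp: axis_def)
      then have "?e \<in> ?W"
        using k \<open>0 < \<eta>\<close> by (simp add: inner_axis abs_sgn_eq flip: abs_sgn)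
      then have "0 < a \<bullet> ?A ?e"
        using bspec[OF ab imageI] \<open>0 < b\<close> by (blast intro: less_trans)
      also have "a \<bullet> ?A ?e = (B *v a) \<bullet> ?e"
        by (rule inner_transpose_matrix_vector)
      finally show ?thesis
        by (simp add: inner_axis mult.commute)
    qed
    then show False
      using primal_optimal_no_descent[OF assms] by blast
  qed
  then obtain w where w: "transpose B *v w = 0" "(\<Sum>k\<in>UNIV. \<bar>w $ k\<bar>) \<le> 1" "?r \<bullet> w = \<eta>"
    by auto
  \<comment> \<open>The norm condition was relaxed to \<open>\<le> 1\<close> to make
    \<open>?W\<close> convex; attaining \<open>\<eta>\<close> forces norm exactly 1.\<close>
  have "\<eta> * 1 \<le> \<eta> * (\<Sum>k\<in>UNIV. \<bar>w $ k\<bar>)"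
    using inner_le_l1[of ?r \<eta> w] primal_optimal_residual_le[OF opt] w by simp
  then have "dual_feasible B w"
    using w \<open>0 < \<eta>\<close> by (simp add: dual_feasible_def)
  then show ?thesis
    using w dual_feasible_inner_residual[of B w f x] by auto
qed

lemma complementary_slackness:
  fixes B :: "real^'n^'m::finite"
  assumes opt: "primal_optimal B f (x, \<eta>)" and dual: "dual_optimal B f w"
  shows "(f - B *v x) $ k * w $ k = \<eta> * \<bar>w $ k\<bar>"
proof -
  let ?r = "f - B *v x"
  have w: "dual_feasible B w" "\<And>w'. dual_feasible B w' \<Longrightarrow> f \<bullet> w' \<le> f \<bullet> w"
    using dual unfolding dual_optimal_def is_arg_max_def by force+
  show ?thesis
  proof (cases "0 < \<eta>")
    case True
    have nonneg: "0 \<le> \<eta> * \<bar>w $ j\<bar> - ?r $ j * w $ j" for j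
      using mult_le_mult_abs[OF primal_optimal_residual_le[OF opt]] by simp
    have "\<eta> \<le> ?r \<bullet> w"
      using ex_dual_feasible_attaining[OF opt True] w dual_feasible_inner_residual[of B w f x] by auto
    \<comment> \<open>As \<open>w\<close> has norm 1, the sum is the duality gap
      \<open>\<eta> - ?r \<bullet> w\<close>; being nonnegative, all its terms must vanish.\<close>
    then have "(\<Sum>j\<in>UNIV. \<eta> * \<bar>w $ j\<bar> - ?r $ j * w $ j) \<le> 0"
      using w(1) unfolding dual_feasible_def
      by (simp add: sum_subtractf inner_vec_def flip: sum_distrib_left)
    then have "(\<Sum>j\<in>UNIV. \<eta> * \<bar>w $ j\<bar> - ?r $ j * w $ j) = 0"
      using nonneg by (intro antisym sum_nonneg) auto
    then show ?thesis
      using nonneg by (simp add: sum_nonneg_eq_0_iff)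
  next
    case False
    then have "\<eta> = 0" "?r $ k = 0"
      using primal_optimal_residual_le[OF opt, of k] by auto
    then show ?thesis
      by simp
  qed
qed

section \<open>The H-set property of the dual support\<close>

lemma dual_feasible_annihilates_span:
  fixes v :: "'n::finite \<Rightarrow> 'a \<Rightarrow> real" and h :: "'m::finite \<Rightarrow> 'a"
  assumes "dual_feasible (sample_matrix v h) w" and "g \<in> fun_space.span (range v)"
  shows "(\<Sum>k\<in>UNIV. w $ k * g (h k)) = 0"
  using assms(2)
proof (induction rule: fun_space.span_induct_alt)
  case base
  then show ?case by simp
next
  case (step c u y)
  then obtain i where "u = v i"
    by blast
  moreover have "(\<Sum>k\<in>UNIV. w $ k * v i (h k)) = (transpose (sample_matrix v h) *v w) $ i"
    by (simp add: matrix_vector_mult_def transpose_def sample_matrix_def mult.commute)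
  ultimately have "(\<Sum>k\<in>UNIV. w $ k * u (h k)) = 0"
    using assms(1) by (simp add: dual_feasible_def)
  moreover have "(\<Sum>k\<in>UNIV. w $ k * (c * u (h k) + y (h k)))
      = c * (\<Sum>k\<in>UNIV. w $ k * u (h k)) + (\<Sum>k\<in>UNIV. w $ k * y (h k))"
    by (simp add: sum_distrib_left sum.distrib algebra_simps)
  ultimately show ?case
    using step by simp
qed

lemma is_H_set_dual_support:
  fixes v :: "'n::finite \<Rightarrow> 'a \<Rightarrow> real" and h :: "'m::finite \<Rightarrow> 'a"
  assumes "dual_feasible (sample_matrix v h) w" and "inj h" and "range h \<subseteq> T"
  shows "is_H_set T (fun_space.span (range v)) (dual_support h w) (dual_sign h w)"
  unfolding is_H_set_def
proof (intro conjI notI)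
  show "dual_support h w \<subseteq> T"
    using assms by (auto simp: dual_support_def)
  show "dual_sign h w ` dual_support h w \<subseteq> {-1, 1}"
    by (auto simp: dual_sign_def sgn_if dual_support_def \<open>inj h\<close>)
  assume "\<exists>g\<in>fun_space.span (range v). \<forall>t\<in>dual_support h w. g t * dual_sign h w t < 0"
  then obtain g where g: "g \<in> fun_space.span (range v)"
    and neg: "\<And>k. w $ k \<noteq> 0 \<Longrightarrow> g (h k) * sgn (w $ k) < 0"
    by (auto simp: dual_support_def dual_sign_def \<open>inj h\<close>)
  have neg': "w $ k * g (h k) < 0" if "w $ k \<noteq> 0" for k
    using neg[OF that] that by (auto simp: sgn_if mult_less_0_iff split: if_splits)
  \<comment> \<open>Norm 1 makes the support nonempty, which is what makes the sum strictly
    negative.\<close>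
  obtain k where "w $ k \<noteq> 0"
    using assms(1) unfolding dual_feasible_def by (metis abs_zero sum.neutral zero_neq_one)
  then have "(\<Sum>k\<in>UNIV. w $ k * g (h k)) < (\<Sum>k\<in>(UNIV::'m set). 0)"
    using neg' by (intro sum_strict_mono_ex1) (auto intro: less_imp_le simp: le_less)
  then show False
    using dual_feasible_annihilates_span[OF assms(1) g] by simp
qed

theorem theorem3:
  fixes T :: "'a::topological_space set"
    and V :: "('a \<Rightarrow> real) set"
    and v :: "'n::finite \<Rightarrow> 'a \<Rightarrow> real"
    and h :: "'m::finite \<Rightarrow> 'a"
    and f :: "real^'m" and x :: "real^'n" and \<eta> :: real and w :: "real^'m"
    and B :: "real^'n^'m"
  assumes "compact T"
    and "V \<subseteq> C_space T"
    and "inj v" and "fun_space.independent (range v)" and "fun_space.span (range v) = V"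
    and "inj h" and "range h \<subseteq> T"
    and "B = sample_matrix v h"
    and "primal_optimal B f (x, \<eta>)"
    and "dual_optimal B f w"
  shows "is_H_set T V (dual_support h w) (dual_sign h w) \<and>
         dual_support h w \<subseteq> extremal_points B f h (x, \<eta>) \<and>
         (\<forall>k. h k \<in> dual_support h w \<and> (f - B *v x) $ k \<noteq> 0 \<longrightarrow>
              dual_sign h w (h k) = sgn ((f - B *v x) $ k))"
proof (intro conjI)
  have w: "dual_feasible B w"
    using assms unfolding dual_optimal_def is_arg_max_def by blast
  show "is_H_set T V (dual_support h w) (dual_sign h w)"
    using is_H_set_dual_support w assms by blast
  let ?r = "f - B *v x"
  \<comment> \<open>Cancelling \<open>w $ k\<close> in complementary slackness yields both the
    modulus of the error, hence extremality, and its sign.\<close>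
  have slack: "?r $ k = \<eta> * sgn (w $ k)" if "w $ k \<noteq> 0" for k
  proof -
    have "?r $ k * w $ k = \<eta> * sgn (w $ k) * w $ k"
      using complementary_slackness[OF assms(9,10), of k]
      by (metis abs_sgn mult.assoc mult.commute)
    then show ?thesis
      using that by (metis mult_right_cancel)
  qed
  have "primal_feasible B f (x, \<eta>)"
    using assms unfolding primal_optimal_def is_arg_min_def by blast
  then have nonneg: "0 \<le> \<eta>"
    unfolding primal_feasible_iff using abs_ge_zero order_trans by blast
  show "dual_support h w \<subseteq> extremal_points B f h (x, \<eta>)"
    unfolding dual_support_def extremal_points_def prod.case
    by (rule image_mono) (use slack nonneg in \<open>auto simp: abs_mult abs_sgn_eq\<close>)
  show "\<forall>k. h k \<in> dual_support h w \<and> ?r $ k \<noteq> 0 \<longrightarrow> dual_sign h w (h k) = sgn (?r $ k)"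
  proof (intro allI impI)
    fix k
    assume k: "h k \<in> dual_support h w \<and> ?r $ k \<noteq> 0"
    then have "w $ k \<noteq> 0"
      using \<open>inj h\<close> by (auto simp: dual_support_def dest: injD)
    \<comment> \<open>If \<open>\<eta> = 0\<close>, then \<open>slack\<close> contradicts the
      nonzero error; otherwise the positive factor \<open>\<eta>\<close> drops out of the
      sign.\<close>
    then show "dual_sign h w (h k) = sgn (?r $ k)"
      using k nonneg slack[of k] \<open>inj h\<close>
      by (cases "\<eta> = 0") (auto simp: dual_sign_def sgn_mult)
  qed
qed

end
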